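(* Let $G$ be a finite graph. Then $$\chi_{id}(G\backslash\mathcal{R})-t(G)\;\leq\; \chi_{id}(G)\;\leq\; \chi_{id}(G\backslash\mathcal{R}).$$
   Context: Graphs are finite, simple and undirected. For a vertex $u$ of $G$, $N[u]$ denotes its closed neighborhood ($u$ together with its neighbors). Two distinct vertices $u,v$ are twins if $N[u]=N[v]$. For a map $c:V(G)\to\mathbb{N}$ (a vertex coloring, not required to be proper) and $X\subseteq V(G)$, $c(X)=\{c(x): x\in X\}$. A pair of vertices $u,v$ is identified by $c$ if $c(N[u])\neq c(N[v])$. An identifying coloring of $G$ is a vertex coloring $c$ of $G$ (not necessarily proper) such that every pair of distinct non-twin vertices (adjacent or not) is identified. $\chi_{id}(G)$ is the smallest number of colors used by an identifying coloring of $G$. Let $\mathcal{R}$ be the equivalence relation on $V(G)$ given by $u\,\mathcal{R}\,v$ iff $N[u]=N[v]$. $G\backslash\mathcal{R}$ denotes the maximal twin-free subgraph of $G$, i.e. the quotient of $G$ by $\mathcal{R}$; equivalently (up to isomorphism) the subgraph of $G$ induced by a set containing exactly one vertex from each $\mathcal{R}$-class. $t(G)$ is the number of $\mathcal{R}$-classes of $G$ having at least two vertices. *)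

theory Defs
  imports "Graph_Theory.Graph_Theory"
begin

text \<open>
  A finite simple undirected graph is a \<open>pair_graph\<close>: a finite loop-free digraph whose arcs are
  pairs of vertices and whose arc relation is symmetric, an edge \<open>uv\<close> being represented by the two
  arcs \<open>(u, v)\<close> and \<open>(v, u)\<close>. The graph with no vertices is allowed.
\<close>

definition closed_nbhd :: "'a pair_pre_digraph \<Rightarrow> 'a \<Rightarrow> 'a set" where
  "closed_nbhd G u = insert u {v. (u, v) \<in> parcs G}"

definition twins :: "'a pair_pre_digraph \<Rightarrow> 'a \<Rightarrow> 'a \<Rightarrow> bool" where
  "twins G u v \<longleftrightarrow> u \<noteq> v \<and> closed_nbhd G u = closed_nbhd G v"

definition identified_by :: "'a pair_pre_digraph \<Rightarrow> ('a \<Rightarrow> nat) \<Rightarrow> 'a \<Rightarrow> 'a \<Rightarrow> bool" where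
  "identified_by G c u v \<longleftrightarrow> c ` closed_nbhd G u \<noteq> c ` closed_nbhd G v"

definition identifying_coloring :: "'a pair_pre_digraph \<Rightarrow> ('a \<Rightarrow> nat) \<Rightarrow> bool" where
  "identifying_coloring G c \<longleftrightarrow>
    (\<forall>u\<in>pverts G. \<forall>v\<in>pverts G. u \<noteq> v \<and> \<not> twins G u v \<longrightarrow> identified_by G c u v)"

text \<open>
  A coloring is a total function, but only its values on the vertices count as colors used.
\<close>

definition chi_id :: "'a pair_pre_digraph \<Rightarrow> nat" where
  "chi_id G = (LEAST k. \<exists>c. identifying_coloring G c \<and> card (c ` pverts G) = k)"

definition twin_rel :: "'a pair_pre_digraph \<Rightarrow> 'a rel" where
  "twin_rel G =
    {(u, v). u \<in> pverts G \<and> v \<in> pverts G \<and> closed_nbhd G u = closed_nbhd G v}"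

text \<open>
  The vertices of the quotient are the twin classes themselves; it is shown below to be isomorphic
  to every subgraph induced by a set of representatives of the classes.
\<close>

definition twin_quotient :: "'a pair_pre_digraph \<Rightarrow> 'a set pair_pre_digraph" where
  "twin_quotient G =
    \<lparr> pverts = pverts G // twin_rel G,
      parcs = {(A, B). A \<in> pverts G // twin_rel G \<and> B \<in> pverts G // twin_rel G \<and> A \<noteq> B \<and>
                       (\<exists>a\<in>A. \<exists>b\<in>B. (a, b) \<in> parcs G)} \<rparr>"

definition num_nontrivial_classes :: "'a pair_pre_digraph \<Rightarrow> nat" where
  "num_nontrivial_classes G = card {A \<in> pverts G // twin_rel G. card A \<ge> 2}"

lemma equiv_twin_rel: "equiv (pverts G) (twin_rel G)"
  by (rule equivI) (auto simp: twin_rel_def refl_on_def sym_def trans_def)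

context pair_graph
begin

lemma closed_nbhd_sym: "v \<in> closed_nbhd G u \<longleftrightarrow> u \<in> closed_nbhd G v"
proof -
  have "sym (parcs G)" using pair_sym_arcs by (simp add: symmetric_def)
  then have "(u, v) \<in> parcs G \<longleftrightarrow> (v, u) \<in> parcs G" by (meson symD)
  then show ?thesis by (auto simp: closed_nbhd_def)
qed

lemma closed_nbhd_subset: "u \<in> pverts G \<Longrightarrow> closed_nbhd G u \<subseteq> pverts G"
  by (auto simp: closed_nbhd_def dest: in_arcsD2)

lemma chi_id_attained: "\<exists>c. identifying_coloring G c \<and> card (c ` pverts G) = chi_id G"
proof -
  obtain c :: "'a \<Rightarrow> nat" where c: "inj_on c (pverts G)"
    using finite_imp_inj_to_nat_seg[OF pair_finite_verts] by blast
  have "identifying_coloring G c"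
    unfolding identifying_coloring_def identified_by_def twins_def
    using inj_on_image_eq_iff[OF c] closed_nbhd_subset by blast
  then have "\<exists>k. \<exists>c. identifying_coloring G c \<and> card (c ` pverts G) = k" by blast
  then show ?thesis unfolding chi_id_def by (rule LeastI_ex)
qed

lemma closed_nbhd_twin_rel:
  assumes "(a, a') \<in> twin_rel G" "(b, b') \<in> twin_rel G"
  shows "b \<in> closed_nbhd G a \<longleftrightarrow> b' \<in> closed_nbhd G a'"
proof -
  have "b \<in> closed_nbhd G a \<longleftrightarrow> b \<in> closed_nbhd G a'" using assms by (simp add: twin_rel_def)
  also have "\<dots> \<longleftrightarrow> a' \<in> closed_nbhd G b" by (rule closed_nbhd_sym)
  also have "\<dots> \<longleftrightarrow> a' \<in> closed_nbhd G b'" using assms by (simp add: twin_rel_def)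
  also have "\<dots> \<longleftrightarrow> b' \<in> closed_nbhd G a'" by (rule closed_nbhd_sym)
  finally show ?thesis .
qed

lemma twin_quotient_arc_iff:
  assumes u: "u \<in> pverts G" and v: "v \<in> pverts G"
  shows "(twin_rel G `` {u}, twin_rel G `` {v}) \<in> parcs (twin_quotient G)
    \<longleftrightarrow> (u, v) \<in> parcs G \<and> (u, v) \<notin> twin_rel G"
proof -
  have ne: "twin_rel G `` {u} = twin_rel G `` {v} \<longleftrightarrow> (u, v) \<in> twin_rel G"
    using eq_equiv_class_iff[OF equiv_twin_rel u v] .
  have uu: "(u, u) \<in> twin_rel G" "(v, v) \<in> twin_rel G" using u v by (auto simp: twin_rel_def)
  have *: "(u, v) \<in> parcs G"
    if ab: "(u, a) \<in> twin_rel G" "(v, b) \<in> twin_rel G" "(a, b) \<in> parcs G" "(u, v) \<notin> twin_rel G" for a b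
  proof -
    have "b \<in> closed_nbhd G a" using ab by (simp add: closed_nbhd_def)
    then have "v \<in> closed_nbhd G u" using closed_nbhd_twin_rel[OF ab(1,2)] by simp
    moreover have "u \<noteq> v" using ab(4) uu by auto
    ultimately show ?thesis by (simp add: closed_nbhd_def)
  qed
  have "(twin_rel G `` {u}, twin_rel G `` {v}) \<in> parcs (twin_quotient G) \<longleftrightarrow>
    (u, v) \<notin> twin_rel G \<and> (\<exists>a b. (u, a) \<in> twin_rel G \<and> (v, b) \<in> twin_rel G \<and> (a, b) \<in> parcs G)"
    using quotientI[OF u, of "twin_rel G"] quotientI[OF v, of "twin_rel G"]
    by (simp add: twin_quotient_def ne Bex_def)
  then show ?thesis using * uu by metis
qed

lemma pair_graph_twin_quotient: "pair_graph (twin_quotient G)"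
proof -
  have s: "sym (parcs G)" using pair_sym_arcs by (simp add: symmetric_def)
  have fin: "finite (pverts G // twin_rel G)"
    using pair_finite_verts by (simp add: quotient_def)
  show ?thesis
  proof
    have "parcs (twin_quotient G) \<subseteq> (pverts G // twin_rel G) \<times> (pverts G // twin_rel G)"
      by (auto simp: twin_quotient_def)
    then show "finite (parcs (twin_quotient G))"
      using fin by (meson finite_SigmaI finite_subset)
    show "symmetric (with_proj (twin_quotient G))"
      using s unfolding symmetric_def sym_def by (auto simp: twin_quotient_def)
  qed (use fin in \<open>auto simp: twin_quotient_def\<close>)
qed

lemma twin_free_twin_quotient:
  assumes "A \<in> pverts (twin_quotient G)" "B \<in> pverts (twin_quotient G)"
  shows "\<not> twins (twin_quotient G) A B"
proof
  let ?c = "\<lambda>u. twin_rel G `` {u}"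
  assume t: "twins (twin_quotient G) A B"
  obtain u v where u: "u \<in> pverts G" "A = ?c u" and v: "v \<in> pverts G" "B = ?c v"
    using assms by (auto simp: twin_quotient_def elim!: quotientE)
  have mem: "?c y \<in> closed_nbhd (twin_quotient G) (?c x) \<longleftrightarrow> y \<in> closed_nbhd G x"
    if x: "x \<in> pverts G" and y: "y \<in> pverts G" for x y
  proof (cases "(x, y) \<in> twin_rel G")
    case True
    then have "?c x = ?c y" using eq_equiv_class_iff[OF equiv_twin_rel x y] by simp
    moreover have "y \<in> closed_nbhd G x" using True by (auto simp: twin_rel_def closed_nbhd_def)
    ultimately show ?thesis by (simp add: closed_nbhd_def)
  next
    case False
    then have "?c x \<noteq> ?c y" "x \<noteq> y"
      using eq_equiv_class_iff[OF equiv_twin_rel x y] y by (auto simp: twin_rel_def)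
    then show ?thesis using twin_quotient_arc_iff[OF x y] False by (auto simp: closed_nbhd_def)
  qed
  have "closed_nbhd (twin_quotient G) (?c u) = closed_nbhd (twin_quotient G) (?c v)"
    using t u v by (simp add: twins_def)
  then have "y \<in> closed_nbhd G u \<longleftrightarrow> y \<in> closed_nbhd G v" if "y \<in> pverts G" for y
    using mem that u v by blast
  then have "closed_nbhd G u = closed_nbhd G v" using closed_nbhd_subset u v by blast
  then have "(u, v) \<in> twin_rel G" using u v by (simp add: twin_rel_def)
  then have "A = B" using eq_equiv_class_iff[OF equiv_twin_rel u(1) v(1)] u v by simp
  then show False using t by (simp add: twins_def)
qed

lemma twin_quotient_iso_induced:
  assumes S: "S \<subseteq> pverts G" and one: "\<And>A. A \<in> pverts G // twin_rel G \<Longrightarrow> \<exists>!s. s \<in> S \<inter> A"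
  shows "digraph_iso (with_proj G \<restriction> S) (with_proj (twin_quotient G))"
proof -
  let ?c = "\<lambda>u. twin_rel G `` {u}"
  define f where "f = \<lparr> iso_verts = ?c, iso_arcs = (\<lambda>(a, b). (?c a, ?c b)),
    iso_head = snd, iso_tail = fst \<rparr>"
  have self: "u \<in> ?c u" if "u \<in> S" for u using that S by (auto simp: twin_rel_def)
  have cl: "?c u \<in> pverts G // twin_rel G" if "u \<in> S" for u using that S by (auto intro: quotientI)
  have inj: "inj_on ?c S"
  proof (rule inj_onI)
    fix u v assume uv: "u \<in> S" "v \<in> S" "?c u = ?c v"
    then have "u \<in> S \<inter> ?c u" "v \<in> S \<inter> ?c u" using self by auto
    then show "u = v" using one[OF cl[OF uv(1)]] by blast
  qed
  have not_tw: "u = v" if "u \<in> S" "v \<in> S" "(u, v) \<in> twin_rel G" for u v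
    using inj that eq_equiv_class_iff[OF equiv_twin_rel, of u G v] S by (auto dest: inj_onD)
  have rep: "\<exists>s\<in>S. A = ?c s" if A: "A \<in> pverts G // twin_rel G" for A
  proof -
    obtain s where s: "s \<in> S" "s \<in> A" using one[OF A] by blast
    have "A = ?c s" using A s(2) Image_singleton_iff
      by (metis equiv_twin_rel equiv_class_eq quotientE)
    then show ?thesis using s by blast
  qed
  have vs: "?c ` S = pverts (twin_quotient G)"
    using rep cl by (auto simp: twin_quotient_def)
  have arc: "(?c u, ?c v) \<in> parcs (twin_quotient G) \<longleftrightarrow> (u, v) \<in> parcs G" if "u \<in> S" "v \<in> S" for u v
    using twin_quotient_arc_iff[of u v] that S not_tw pair_no_loops[of "(u, v)"] by auto
  have as: "(\<lambda>(a, b). (?c a, ?c b)) ` {e \<in> parcs G. fst e \<in> S \<and> snd e \<in> S} = parcs (twin_quotient G)"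
    (is "?L = ?R")
  proof
    show "?L \<subseteq> ?R" using arc by auto
    show "?R \<subseteq> ?L"
    proof
      fix e assume e: "e \<in> ?R"
      then have "fst e \<in> pverts G // twin_rel G" "snd e \<in> pverts G // twin_rel G"
        by (auto simp: twin_quotient_def)
      then obtain a b where ab: "a \<in> S" "fst e = ?c a" "b \<in> S" "snd e = ?c b" by (metis rep)
      then have "e = (?c a, ?c b)" by (metis prod.collapse)
      moreover from this have "(a, b) \<in> parcs G" using ab arc e by simp
      ultimately show "e \<in> ?L" using ab by (intro rev_image_eqI[where x = "(a, b)"]) auto
    qed
  qed
  have wf: "wf_digraph (with_proj G \<restriction> S)" by (rule wellformed_induce_subgraph)
  have "pre_digraph.digraph_isomorphism (with_proj G \<restriction> S) f"
    unfolding pre_digraph.digraph_isomorphism_def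
    using wf inj by (auto simp: f_def inj_on_def)
  moreover have "with_proj (twin_quotient G) = app_iso f (with_proj G \<restriction> S)"
    unfolding app_iso_def using vs as by (simp add: f_def with_proj_def)
  ultimately show ?thesis unfolding digraph_iso_def by blast
qed

end

end

theory Submission
  imports Defs
begin

text \<open>
  For the upper bound, every vertex receives the color of its class. For the lower bound, an optimal
  coloring of \<open>G\<close> is kept on the singleton classes, while each of the \<open>t(G)\<close> other classes receives a
  fresh private color. The colors that the quotient coloring shows around a class then determine which
  nontrivial classes are adjacent, and hence the whole color set seen by its members in \<open>G\<close>.
\<close>

lemma chi_id_le: "identifying_coloring G c \<Longrightarrow> chi_id G \<le> card (c ` pverts G)"
  unfolding chi_id_def by (rule Least_le) blast

text \<open>Contrapositive form. Distinctness and not being twins merge into the single condition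
  that the closed neighborhoods differ.\<close>

lemma identifying_coloring_iff:
  "identifying_coloring G c \<longleftrightarrow>
    (\<forall>u\<in>pverts G. \<forall>v\<in>pverts G.
      c ` closed_nbhd G u = c ` closed_nbhd G v \<longrightarrow> closed_nbhd G u = closed_nbhd G v)"
  unfolding identifying_coloring_def identified_by_def twins_def by metis

lemma pverts_twin_quotient: "pverts (twin_quotient G) = (\<lambda>u. twin_rel G `` {u}) ` pverts G"
  by (auto simp: twin_quotient_def quotient_def)

context pair_graph
begin

text \<open>Adjacency of distinct classes does not depend on the representatives; if the classes
  coincide, both sides are true because neighborhoods are closed.\<close>

lemma closed_nbhd_twin_quotient_iff:
  assumes u: "u \<in> pverts G" and v: "v \<in> pverts G"
  shows "twin_rel G `` {v} \<in> closed_nbhd (twin_quotient G) (twin_rel G `` {u})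
    \<longleftrightarrow> v \<in> closed_nbhd G u"
proof (cases "(u, v) \<in> twin_rel G")
  case True
  then have "twin_rel G `` {u} = twin_rel G `` {v}"
    using eq_equiv_class_iff[OF equiv_twin_rel u v] by simp
  moreover have "v \<in> closed_nbhd G u" using True by (auto simp: twin_rel_def closed_nbhd_def)
  ultimately show ?thesis by (simp add: closed_nbhd_def)
next
  case False
  then have "twin_rel G `` {u} \<noteq> twin_rel G `` {v}" "u \<noteq> v"
    using eq_equiv_class_iff[OF equiv_twin_rel u v] v by (auto simp: twin_rel_def)
  then show ?thesis using twin_quotient_arc_iff[OF u v] False by (auto simp: closed_nbhd_def)
qed

text \<open>Lets color sets in the quotient be computed inside \<open>G\<close>, which both bounds
  rely on.\<close>

lemma closed_nbhd_twin_quotient: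
  assumes u: "u \<in> pverts G"
  shows "closed_nbhd (twin_quotient G) (twin_rel G `` {u})
    = (\<lambda>v. twin_rel G `` {v}) ` closed_nbhd G u" (is "?L = ?R")
proof
  have "?L \<subseteq> pverts (twin_quotient G)"
    using u by (auto simp: closed_nbhd_def twin_quotient_def intro: quotientI)
  then show "?L \<subseteq> ?R"
    using closed_nbhd_twin_quotient_iff[OF u] by (auto simp: pverts_twin_quotient)
  show "?R \<subseteq> ?L"
    using closed_nbhd_twin_quotient_iff[OF u] closed_nbhd_subset[OF u] by auto
qed

lemma closed_nbhd_eq_imp_twin_class_eq:
  assumes "u \<in> pverts G" "v \<in> pverts G" "closed_nbhd G u = closed_nbhd G v"
  shows "twin_rel G `` {u} = twin_rel G `` {v}"
  using eq_equiv_class_iff[OF equiv_twin_rel assms(1,2)] assms by (simp add: twin_rel_def)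

text \<open>The lifted coloring shows around \<open>u\<close> exactly the colors that
  \<open>d\<close> shows around the class of \<open>u\<close>, and equal neighborhoods in the
  quotient pull back to equal neighborhoods in \<open>G\<close>.\<close>

lemma identifying_coloring_lift:
  assumes "identifying_coloring (twin_quotient G) d"
  shows "identifying_coloring G (\<lambda>u. d (twin_rel G `` {u}))"
  unfolding identifying_coloring_iff
proof (intro ballI impI)
  fix u v
  assume uv: "u \<in> pverts G" "v \<in> pverts G"
    and eq: "(\<lambda>u. d (twin_rel G `` {u})) ` closed_nbhd G u
      = (\<lambda>u. d (twin_rel G `` {u})) ` closed_nbhd G v"
  have "d ` closed_nbhd (twin_quotient G) (twin_rel G `` {u})
      = d ` closed_nbhd (twin_quotient G) (twin_rel G `` {v})"
    using eq by (simp add: closed_nbhd_twin_quotient uv image_image)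
  then have "closed_nbhd (twin_quotient G) (twin_rel G `` {u})
      = closed_nbhd (twin_quotient G) (twin_rel G `` {v})"
    using assms uv unfolding identifying_coloring_iff pverts_twin_quotient by blast
  then show "closed_nbhd G u = closed_nbhd G v"
    using closed_nbhd_twin_quotient_iff uv closed_nbhd_subset by blast
qed

lemma chi_id_le_twin_quotient: "chi_id G \<le> chi_id (twin_quotient G)"
proof -
  interpret Q: pair_graph "twin_quotient G" by (rule pair_graph_twin_quotient)
  obtain d where d: "identifying_coloring (twin_quotient G) d"
      "card (d ` pverts (twin_quotient G)) = chi_id (twin_quotient G)"
    using Q.chi_id_attained by blast
  from chi_id_le[OF identifying_coloring_lift[OF d(1)]] d(2) show ?thesis
    by (simp add: pverts_twin_quotient image_image)
qed

lemma twin_class_eq_singleton: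
  assumes "u \<in> pverts G" "\<not> card (twin_rel G `` {u}) \<ge> 2"
  shows "twin_rel G `` {u} = {u}"
proof -
  have mem: "u \<in> twin_rel G `` {u}" using assms(1) by (simp add: twin_rel_def)
  \<comment> \<open>Since \<open>card\<close> is 0 on infinite sets, finiteness is needed before a
    member can rule out the value 0.\<close>
  have "finite (twin_rel G `` {u})"
    by (rule finite_subset[OF _ pair_finite_verts]) (auto simp: twin_rel_def)
  with mem have "card (twin_rel G `` {u}) \<noteq> 0" by auto
  then have "card (twin_rel G `` {u}) = 1" using assms(2) by linarith
  then show ?thesis using mem by (metis card_1_singletonE singletonD)
qed

text \<open>The lower bound in additive form, as subtraction on \<open>nat\<close> truncates at
  0.\<close>

lemma chi_id_twin_quotient_le:
  "chi_id (twin_quotient G) \<le> chi_id G + num_nontrivial_classes G"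
proof -
  let ?cl = "\<lambda>u. twin_rel G `` {u}"
  define T where "T = {A \<in> pverts G // twin_rel G. card A \<ge> 2}"
  have finT: "finite T" using pair_finite_verts by (simp add: T_def quotient_def)
  obtain c where c: "identifying_coloring G c" "card (c ` pverts G) = chi_id G"
    using chi_id_attained by blast
  obtain g :: "'a set \<Rightarrow> nat" where g: "inj_on g T"
    using finite_imp_inj_to_nat_seg[OF finT] by blast
  \<comment> \<open>Shifting by this strict bound keeps the private colors \<open>M + g A\<close>
    apart from every color that \<open>c\<close> uses on a vertex.\<close>
  obtain M where M: "c x < M" if "x \<in> pverts G" for x
    using pair_finite_verts finite_nat_set_iff_bounded[of "c ` pverts G"] by blast
  define d where "d A = (if A \<in> T then M + g A else c (the_elem A))" for A
  have single: "?cl x = {x}" "d (?cl x) = c x" if "x \<in> pverts G" "?cl x \<notin> T" for x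
  proof -
    show "?cl x = {x}"
      using that twin_class_eq_singleton by (auto simp: T_def intro: quotientI)
    then show "d (?cl x) = c x" using that by (simp add: d_def)
  qed
  \<comment> \<open>Only inclusions are compared, so that one argument serves both directions of the
    equality needed below.\<close>
  have sub: "c ` closed_nbhd G u \<subseteq> c ` closed_nbhd G v"
    if uv: "u \<in> pverts G" "v \<in> pverts G"
      and le: "d ` ?cl ` closed_nbhd G u \<subseteq> d ` ?cl ` closed_nbhd G v" for u v
  proof
    fix k assume "k \<in> c ` closed_nbhd G u"
    then obtain x where x: "x \<in> closed_nbhd G u" "k = c x" by blast
    have xV: "x \<in> pverts G" using x closed_nbhd_subset uv by blast
    obtain y where y: "y \<in> closed_nbhd G v" "d (?cl x) = d (?cl y)" using x le by blast
    have yV: "y \<in> pverts G" using y closed_nbhd_subset uv by blast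
    show "k \<in> c ` closed_nbhd G v"
    proof (cases "?cl x \<in> T")
      case True
      \<comment> \<open>A class outside \<open>T\<close> has a color below \<open>M\<close>, whereas
        the color of \<open>?cl x\<close> is at least \<open>M\<close>.\<close>
      then have yT: "?cl y \<in> T"
        using y(2) single(2)[OF yV] M[OF yV] by (auto simp: d_def split: if_splits)
      then have "g (?cl x) = g (?cl y)" using True y(2) by (simp add: d_def)
      then have "?cl x = ?cl y" using g True yT by (auto dest: inj_onD)
      \<comment> \<open>A closed neighborhood is a union of twin classes, so it contains
        \<open>x\<close> along with \<open>y\<close>.\<close>
      then have "x \<in> closed_nbhd G v"
        using y(1) closed_nbhd_twin_quotient_iff uv(2) xV yV by metis
      then show ?thesis using x by blast
    next
      case False
      then have "?cl y \<notin> T"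
        using y(2) single(2)[OF xV] M[OF xV] by (auto simp: d_def split: if_splits)
      then have "c x = c y" using y(2) single(2) False xV yV by simp
      then show ?thesis using x y by blast
    qed
  qed
  have "identifying_coloring (twin_quotient G) d"
    unfolding identifying_coloring_iff
  proof (intro ballI impI)
    fix A B
    assume AB: "A \<in> pverts (twin_quotient G)" "B \<in> pverts (twin_quotient G)"
      and eq: "d ` closed_nbhd (twin_quotient G) A = d ` closed_nbhd (twin_quotient G) B"
    obtain u v where uv: "u \<in> pverts G" "A = ?cl u" "v \<in> pverts G" "B = ?cl v"
      using AB by (auto simp: pverts_twin_quotient)
    have "d ` ?cl ` closed_nbhd G u = d ` ?cl ` closed_nbhd G v"
      using eq uv by (simp add: closed_nbhd_twin_quotient)
    then have "c ` closed_nbhd G u = c ` closed_nbhd G v"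
      using sub uv by (intro equalityI) auto
    then have "closed_nbhd G u = closed_nbhd G v"
      using c(1) uv by (auto simp: identifying_coloring_iff)
    \<comment> \<open>Vertices with the same closed neighborhood lie in one class, so
      \<open>A\<close> and \<open>B\<close> coincide.\<close>
    then show "closed_nbhd (twin_quotient G) A = closed_nbhd (twin_quotient G) B"
      using closed_nbhd_eq_imp_twin_class_eq[OF uv(1,3)] uv(2,4) by simp
  qed
  then have "chi_id (twin_quotient G) \<le> card (d ` pverts (twin_quotient G))" by (rule chi_id_le)
  \<comment> \<open>Singleton classes reuse colors of \<open>c\<close>; all other colors come from
    \<open>T\<close>.\<close>
  also have "\<dots> \<le> card (c ` pverts G \<union> d ` T)"
    using single(2) pair_finite_verts finT
    by (intro card_mono) (auto simp: pverts_twin_quotient)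
  also have "\<dots> \<le> card (c ` pverts G) + card (d ` T)" by (rule card_Un_le)
  also have "\<dots> \<le> chi_id G + num_nontrivial_classes G"
    using c(2) card_image_le[OF finT, of d] by (simp add: num_nontrivial_classes_def T_def)
  finally show ?thesis .
qed

end

theorem theorem1p2:
  fixes G :: "'a pair_pre_digraph"
  assumes "pair_graph G"
  shows "int (chi_id (twin_quotient G)) - int (num_nontrivial_classes G) \<le> int (chi_id G)
    \<and> chi_id G \<le> chi_id (twin_quotient G)"
  using pair_graph.chi_id_le_twin_quotient[OF assms] pair_graph.chi_id_twin_quotient_le[OF assms]
  by linarith

end
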